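(* Let $m$ be a positive integer, $q=2^m$, and let $n$ be an odd positive integer. Let $L(x)\in\mathbb{F}_q[x]$ be a linearized polynomial such that $xL(x)$ is a permutation polynomial over $\mathbb{F}_q$, and let $g(x)\in\mathbb{F}_q[x]$ be the compositional inverse of $xL(x)$ over $\mathbb{F}_q$. Let $a\in\mathbb{F}_q^*$ and let \[F(x)=x\left(L(\mathrm{Tr}(x))+a\,\mathrm{Tr}(x)+ax\right),\] which is a permutation polynomial over $\mathbb{F}_{q^n}$. Then the compositional inverse of $F$ over $\mathbb{F}_{q^n}$ is \begin{align*} F^{-1}(x)={}&a^{2^{m-1}-1}x^{2^{nm-1}}\\ &+\left(g(\mathrm{Tr}(x))+a^{2^{m-1}-1}\sum_{k=1}^{\frac{n-1}{2}}x^{2^{(2k-1)m-1}}\right)\left(\frac{\mathrm{Tr}(x)}{g(\mathrm{Tr}(x))}+a\,g(\mathrm{Tr}(x))\right)^{q-1}\\ &+\sum_{j=0}^{m-2}a^{2^{j}-1}\left(\frac{\mathrm{Tr}(x)}{g(\mathrm{Tr}(x))}+a\,g(\mathrm{Tr}(x))\right)^{2^m-2^{j+1}}\left(\sum_{k=0}^{\frac{n-1}{2}}x^{q^{2k}}\right)^{2^j}. \end{align*}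
   Context: $\mathrm{Tr}(x)=\sum_{i=0}^{n-1}x^{q^i}$ is the trace map from $\mathbb{F}_{q^n}$ to $\mathbb{F}_q$. A linearized polynomial over $\mathbb{F}_q=\mathbb{F}_{2^m}$ is here a polynomial of the form $L(x)=\sum_{i=0}^{m-1}l_ix^{2^i}$ with $l_i\in\mathbb{F}_q$. A polynomial over a finite field $K$ is a permutation polynomial over $K$ if the map $K\to K$ it induces is bijective; its compositional inverse over $K$ is the polynomial (unique modulo $x^{|K|}-x$) inducing the inverse map, so identities between polynomials over $K$ are understood modulo $x^{|K|}-x$, i.e. as identities of maps on $K$. Convention for fractions: $\frac{1}{0}$ is interpreted as $0$ (so $\frac1y$ stands for $y^{q^n-2}$ on $\mathbb{F}_{q^n}$); in particular $\frac{\mathrm{Tr}(x)}{g(\mathrm{Tr}(x))}=0$ when $g(\mathrm{Tr}(x))=0$. Empty sums are $0$. That $F$ is a permutation polynomial over $\mathbb{F}_{q^n}$ is a known result (Laigle-Chapuy). *)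

theory Defs
  imports "HOL-Computational_Algebra.Polynomial"
begin

definition is_subfield :: "'a::field set \<Rightarrow> bool" where
  "is_subfield K \<longleftrightarrow> 0 \<in> K \<and> 1 \<in> K \<and>
     (\<forall>x\<in>K. \<forall>y\<in>K. x + y \<in> K \<and> x * y \<in> K) \<and>
     (\<forall>x\<in>K. - x \<in> K \<and> inverse x \<in> K)"

definition poly_over :: "'a::field set \<Rightarrow> 'a poly \<Rightarrow> bool" where
  "poly_over K p \<longleftrightarrow> (\<forall>i. coeff p i \<in> K)"

definition linearized_poly :: "'a::field set \<Rightarrow> nat \<Rightarrow> 'a poly \<Rightarrow> bool" where
  "linearized_poly K m L \<longleftrightarrow>
     (\<exists>l. (\<forall>i<m. l i \<in> K) \<and> L = (\<Sum>i<m. monom (l i) (2 ^ i)))"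

definition permutation_poly :: "'a::field set \<Rightarrow> 'a poly \<Rightarrow> bool" where
  "permutation_poly K p \<longleftrightarrow> poly_over K p \<and> bij_betw (poly p) K K"

text \<open>A relation rather than a function, because a compositional inverse over a finite field
  \<open>K\<close> is determined only modulo \<open>X ^ card K - X\<close>, that is, through the map it induces
  on \<open>K\<close>.\<close>

definition compositional_inverse :: "'a::field set \<Rightarrow> 'a poly \<Rightarrow> 'a poly \<Rightarrow> bool" where
  "compositional_inverse K p r \<longleftrightarrow> permutation_poly K p \<and> poly_over K r \<and>
     (\<forall>y\<in>K. poly r y = inv_into K (poly p) y)"

definition trace_poly :: "nat \<Rightarrow> nat \<Rightarrow> 'a::field poly" where
  "trace_poly q n = (\<Sum>i<n. monom 1 (q ^ i))"

definition F_poly :: "nat \<Rightarrow> nat \<Rightarrow> 'a::field \<Rightarrow> 'a poly \<Rightarrow> 'a poly" where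
  "F_poly q n a L =
     monom 1 1 * (pcompose L (trace_poly q n) + smult a (trace_poly q n) + monom a 1)"

text \<open>The explicit formula, as a map. Division is that of the type class, where
  \<open>y / 0 = 0\<close>, so \<open>Tr(x) / g(Tr(x))\<close> is \<open>0\<close> whenever \<open>g(Tr(x)) = 0\<close>.
  The index set \<open>{..<m - 1}\<close> is \<open>0, ..., m - 2\<close>, and is empty for \<open>m = 1\<close>. For
  positive \<open>m\<close> and \<open>n\<close>, no subtraction in an exponent is truncated.\<close>

definition F_inverse_formula ::
    "nat \<Rightarrow> nat \<Rightarrow> 'a::field \<Rightarrow> 'a poly \<Rightarrow> 'a \<Rightarrow> 'a" where
  "F_inverse_formula m n a g x =
     (let q = 2 ^ m;
          t = poly (trace_poly q n) x;
          u = poly g t;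
          w = t / u + a * u
      in a ^ (2 ^ (m - 1) - 1) * x ^ (2 ^ (n * m - 1))
         + (u + a ^ (2 ^ (m - 1) - 1) *
                 (\<Sum>k = 1..(n - 1) div 2. x ^ (2 ^ ((2 * k - 1) * m - 1)))) * w ^ (q - 1)
         + (\<Sum>j<m - 1. a ^ (2 ^ j - 1) * w ^ (2 ^ m - 2 ^ (j + 1)) *
                 (\<Sum>k = 0..(n - 1) div 2. x ^ (q ^ (2 * k))) ^ (2 ^ j)))"

end

theory Submission imports Defs
begin

text \<open>With \<open>y = F(x)\<close> and \<open>T = Tr(x)\<close>, characteristic 2 gives \<open>Tr(y) = T L(T)\<close>, so \<open>g\<close> recovers \<open>T\<close>,
  and \<open>w = L(T) + a T\<close> lies in \<open>K\<close> and satisfies \<open>y = w x + a x\<^sup>2\<close>. If \<open>w = 0\<close>, then only the first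
  term of the formula survives and it is the square root of \<open>y / a\<close>. Otherwise put
  \<open>S(x) = \<Sum>k\<le>(n-1)/2. x ^ (q ^ (2k))\<close> and \<open>z = a S(x) / w\<close>. Then \<open>a S(y) / w\<^sup>2 = z + z\<^sup>2\<close>, and the
  formula collapses to \<open>T + (w / a) (\<Sum>j<m. (z + z\<^sup>2) ^ (2 ^ j))\<close>. This sum telescopes to \<open>z + z ^ q\<close>, and
  \<open>S(x) + S(x) ^ q = Tr(x) + x\<close> because \<open>n\<close> is odd. Hence the formula is a left inverse
  of \<open>F\<close>, which on a finite set also makes \<open>F\<close> bijective.\<close>

text \<open>Multiplication by a nonzero \<open>x\<close> permutes \<open>K - {0}\<close>. Comparing
  the product of all its elements before and after gives
  \<open>x ^ (card K - 1) = 1\<close>.\<close>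

lemma subfield_power_card:
  fixes K :: "'a::field set"
  assumes K: "is_subfield K" "finite K" and x: "x \<in> K"
  shows "x ^ card K = x"
proof (cases "x = 0")
  case True
  have "0 \<in> K" using K(1) by (simp add: is_subfield_def)
  hence "card K > 0" using K(2) card_gt_0_iff by blast
  thus ?thesis using True by simp
next
  case False
  let ?U = "K - {0}"
  have K0: "0 \<in> K" and mult: "\<And>u v. u \<in> K \<Longrightarrow> v \<in> K \<Longrightarrow> u * v \<in> K"
    and inv: "\<And>u. u \<in> K \<Longrightarrow> inverse u \<in> K"
    using K(1) by (auto simp: is_subfield_def)
  have "bij_betw ((*) x) ?U ?U"
    by (rule bij_betw_byWitness[where f' = "(*) (inverse x)"])
       (use False x mult inv in \<open>auto simp flip: mult.assoc\<close>)
  hence "prod ((*) x) ?U = \<Prod>?U"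
    using prod.reindex_bij_betw[of "(*) x" ?U ?U "\<lambda>u. u"] by simp
  moreover have "prod ((*) x) ?U = x ^ card ?U * \<Prod>?U"
    by (simp add: prod.distrib)
  moreover have "\<Prod>?U \<noteq> 0" using K(2) by simp
  ultimately have "x ^ card ?U = 1" by simp
  moreover have "card K = Suc (card ?U)"
    using K(2) K0 by (metis card.remove)
  ultimately show ?thesis by simp
qed

text \<open>The fixed points are roots of a polynomial of degree at most \<open>card K\<close>, and
  \<open>K\<close> already supplies that many. This is the test by which the trace is shown to lie
  in \<open>K\<close>.\<close>

lemma subfield_eq_fixed_points:
  fixes K :: "'a::{field,finite} set"
  assumes K: "is_subfield K"
  shows "K = {x. x ^ card K = x}"
proof (rule card_seteq)
  let ?q = "card K"
  let ?p = "monom 1 ?q - monom 1 1 :: 'a poly"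
  \<comment> \<open>With \<open>card K\<close> at least 2 the two monomials of \<open>?p\<close>
    have different degrees, so \<open>?p\<close> is not zero.\<close>
  have "card {0, 1 :: 'a} \<le> ?q"
    using K by (intro card_mono) (auto simp: is_subfield_def)
  hence q2: "?q \<ge> 2" by simp
  hence "coeff ?p ?q = 1" by simp
  hence "?p \<noteq> 0" by (metis coeff_0 zero_neq_one)
  moreover have "degree ?p \<le> ?q"
    using q2 by (intro degree_diff_le) (auto intro: order_trans[OF degree_monom_le])
  ultimately have "card {x. poly ?p x = 0} \<le> ?q"
    using card_poly_roots_bound[of ?p] by simp
  thus "card {x :: 'a. x ^ ?q = x} \<le> ?q" by (simp add: poly_monom)
qed (use subfield_power_card[OF K] in auto)

text \<open>Translation by 1 permutes the field, so summing all elements shows that the cardinality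
  vanishes in the field. The characteristic is thus a prime divisor of a power of 2.\<close>

lemma CHAR_eq_2_if_card_power_of_2:
  assumes "card (UNIV :: 'a::{field,finite} set) = 2 ^ N"
  shows "CHAR('a) = 2"
proof -
  have p: "prime CHAR('a)"
    by (intro prime_CHAR_semidom finite_imp_CHAR_pos) simp
  have "bij_betw (\<lambda>y. y + 1 :: 'a) UNIV UNIV"
    by (rule bij_betw_byWitness[where f' = "\<lambda>y. y - 1"]) auto
  hence "(\<Sum>y\<in>UNIV. y + 1 :: 'a) = (\<Sum>y\<in>UNIV. y)"
    by (rule sum.reindex_bij_betw)
  hence "of_nat (2 ^ N) = (0 :: 'a)"
    by (simp add: sum.distrib assms)
  hence "CHAR('a) dvd 2 ^ N" by (simp only: of_nat_eq_0_iff_char_dvd)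
  thus ?thesis using p by (metis prime_dvd_power primes_dvd_imp_eq two_is_prime_nat)
qed

text \<open>The \<open>q\<close>-th power moves the even Frobenius exponents to the odd ones, and
  the two families interleave. For \<open>n = 2*h+1\<close> the right side becomes the trace of
  \<open>x\<close> plus \<open>x\<close> itself.\<close>

lemma sum_even_frobenius_powers:
  fixes x :: "'a::comm_semiring_1"
  assumes "prime CHAR('a)" and "q = CHAR('a) ^ m"
  shows "(\<Sum>k=0..h. x ^ (q ^ (2*k))) + (\<Sum>k=0..h. x ^ (q ^ (2*k))) ^ q
       = (\<Sum>i<2*h+1. x ^ (q ^ i)) + x ^ (q ^ (2*h+1))"
proof -
  have "(\<Sum>k=0..h. x ^ (q ^ (2*k))) ^ q = (\<Sum>k=0..h. x ^ (q ^ Suc (2*k)))"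
    by (simp add: freshmans_dream_sum'[OF assms] mult.commute flip: power_mult)
  moreover have "(\<Sum>k=0..h. x ^ (q ^ (2*k))) + (\<Sum>k=0..h. x ^ (q ^ Suc (2*k)))
      = (\<Sum>i<Suc (2*h+1). x ^ (q ^ i))"
    by (induction h) (simp_all add: algebra_simps)
  ultimately show ?thesis by simp
qed

text \<open>In characteristic 2 each summand is the difference of two consecutive terms of the
  sequence \<open>z ^ (2 ^ j)\<close>.\<close>

lemma sum_artin_schreier_telescope:
  fixes z :: "'a::comm_ring_1"
  assumes "CHAR('a) = 2"
  shows "(\<Sum>j<m. (z + z^2) ^ (2 ^ j)) = z + z ^ (2 ^ m)"
proof -
  have "(z + z^2) ^ (2 ^ j) = z ^ (2 ^ Suc j) - z ^ (2 ^ j)" for j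
  proof -
    have "(z + z^2) ^ (2 ^ j) = z ^ (2 ^ j) + z ^ (2 ^ Suc j)"
      using freshmans_dream'[of "2 ^ j" j z "z^2"] assms by (simp flip: power_mult)
    thus ?thesis using minus_CHAR_2[OF assms] by (simp add: add.commute)
  qed
  hence "(\<Sum>j<m. (z + z^2) ^ (2 ^ j)) = z ^ (2 ^ m) - z"
    using sum_lessThan_telescope[of "\<lambda>j. z ^ (2 ^ j)" m] by simp
  thus ?thesis using minus_CHAR_2[OF assms] by (simp add: add.commute)
qed

lemma F_inverse_formula_F_poly:
  fixes K :: "'a::{field,finite} set"
  assumes m: "m > 0" and q: "q = 2 ^ m" and n: "odd n"
    and cU: "card (UNIV :: 'a set) = q ^ n"
    and K: "is_subfield K" "card K = q"
    and L: "linearized_poly K m L"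
    and g: "compositional_inverse K (monom 1 1 * L) g"
    and a: "a \<in> K" "a \<noteq> 0"
  shows "F_inverse_formula m n a g (poly (F_poly q n a L) x) = x"
proof -
  obtain h where h: "n = 2 * h + 1" using n by (auto elim: oddE)
  have c2: "CHAR('a) = 2"
    using cU q by (intro CHAR_eq_2_if_card_power_of_2[of "m * n"]) (simp add: power_mult)
  have pc: "prime CHAR('a)" and qc: "q = CHAR('a) ^ m" using c2 q by simp_all
  have dbl: "u + u = 0" for u :: 'a
    using minus_CHAR_2[OF c2] by (metis diff_self)
  have K0: "0 \<in> K" and add: "\<And>u v. u \<in> K \<Longrightarrow> v \<in> K \<Longrightarrow> u + v \<in> K"
    and mult: "\<And>u v. u \<in> K \<Longrightarrow> v \<in> K \<Longrightarrow> u * v \<in> K"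
    and K1: "1 \<in> K" using K(1) by (auto simp: is_subfield_def)
  have pow: "u ^ i \<in> K" if "u \<in> K" for u i
    using that by (induction i) (auto intro: K1 mult)
  have Kq: "u ^ q = u" if "u \<in> K" for u
    using subfield_power_card[OF K(1) _ that] K(2) by simp
  have Kqi: "u ^ (q ^ i) = u" if "u \<in> K" for u i
    using Kq[OF that] by (induction i) (simp_all add: power_mult)
  have Uq: "u ^ (q ^ n) = u" for u :: 'a
    using subfield_power_card[of "UNIV :: 'a set" u] cU by (simp add: is_subfield_def)
  have frob: "(u + v) ^ (q ^ i) = u ^ (q ^ i) + v ^ (q ^ i)" for u v :: 'a and i
    by (rule freshmans_dream'[OF pc, of _ "m * i"]) (simp add: qc power_mult)
  define T where "T = poly (trace_poly q n) x"
  define y where "y = poly (F_poly q n a L) x"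
  define w where "w = poly L T + a * T"
  have tr: "poly (trace_poly q n) u = (\<Sum>i<n. u ^ (q ^ i))" for u :: 'a
    by (simp add: trace_poly_def poly_sum poly_monom)
  have q2: "q \<ge> 2" using q m by (metis self_le_power one_le_numeral)
  have qpos: "q > 0" using q2 by simp
  \<comment> \<open>The \<open>q\<close>-th power shifts the summation range by one, and the end
    terms \<open>x ^ (q ^ n)\<close> and \<open>x\<close> agree.\<close>
  have TK: "T \<in> K"
  proof -
    have "T ^ q = (\<Sum>i<n. x ^ (q ^ Suc i))"
      unfolding T_def tr by (simp add: freshmans_dream_sum'[OF pc qc] mult.commute flip: power_mult)
    also have "\<dots> = (\<Sum>i<Suc n. x ^ (q ^ i)) - x"
      by (subst sum.lessThan_Suc_shift) simp
    also have "\<dots> = T" by (simp add: T_def tr Uq)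
    finally show ?thesis
      using subfield_eq_fixed_points[OF K(1)] K(2) by auto
  qed
  obtain l where l: "\<And>i. i < m \<Longrightarrow> l i \<in> K" "L = (\<Sum>i<m. monom (l i) (2 ^ i))"
    using L by (auto simp: linearized_poly_def)
  have L0: "poly L 0 = 0" by (simp add: l(2) poly_sum poly_monom power_0_left)
  have LK: "poly L T \<in> K"
  proof -
    have "(\<Sum>i<j. l i * T ^ (2 ^ i)) \<in> K" if "j \<le> m" for j
      using that by (induction j) (auto intro!: K0 add mult pow TK l(1))
    thus ?thesis by (simp add: l(2) poly_sum poly_monom)
  qed
  have wK: "w \<in> K" unfolding w_def by (intro add mult LK TK a)
  have y: "y = w * x + a * x^2"
    by (simp add: y_def F_poly_def w_def T_def poly_monom poly_pcompose algebra_simps power2_eq_square)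
  \<comment> \<open>The coefficients \<open>w\<close> and \<open>a\<close> lie in \<open>K\<close>,
    hence are fixed by every power \<open>q ^ i\<close>.\<close>
  have ypow: "y ^ (q ^ i) = w * x ^ (q ^ i) + a * (x ^ (q ^ i))^2" for i
    by (simp add: y frob power_mult_distrib Kqi wK a mult.commute flip: power_mult)
  have sq_sum: "(\<Sum>i\<in>A. f i ^ 2) = (sum f A)^2" for f :: "nat \<Rightarrow> 'a" and A
    using freshmans_dream_sum[OF pc, of 2 f A] c2 by simp
  have "poly (trace_poly q n) y = w * T + a * T^2"
    by (simp add: tr ypow T_def sum.distrib flip: sum_distrib_left sq_sum)
  also have "\<dots> = T * poly L T"
    using dbl[of "a * T^2"] by (simp add: w_def algebra_simps power2_eq_square)
  finally have ty: "poly (trace_poly q n) y = T * poly L T" .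
  have u: "poly g (T * poly L T) = T"
  proof -
    have inj: "inj_on (poly (monom 1 1 * L)) K" 
      and gi: "\<And>v. v \<in> K \<Longrightarrow> poly g v = inv_into K (poly (monom 1 1 * L)) v"
      using g by (auto simp: compositional_inverse_def permutation_poly_def bij_betw_def)
    have "poly g (poly (monom 1 1 * L) T) = T"
      using inv_into_f_f[OF inj TK] mult[OF TK LK] by (simp add: gi poly_monom)
    thus ?thesis by (simp add: poly_monom)
  qed
  \<comment> \<open>For \<open>T = 0\<close> the quotient is 0 by convention, which agrees with
    \<open>L0\<close>.\<close>
  have w: "T * poly L T / T + a * T = w"
    using L0 by (cases "T = 0") (simp_all add: w_def)
  define S where "S v = (\<Sum>k=0..h. v ^ (q ^ (2*k)))" for v :: 'a
  have formula: "F_inverse_formula m n a g y =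
      a ^ (2 ^ (m - 1) - 1) * y ^ (2 ^ (n * m - 1))
         + (T + a ^ (2 ^ (m - 1) - 1) *
                 (\<Sum>k = 1..h. y ^ (2 ^ ((2 * k - 1) * m - 1)))) * w ^ (q - 1)
         + (\<Sum>j<m - 1. a ^ (2 ^ j - 1) * w ^ (2 ^ m - 2 ^ (j + 1)) * S y ^ (2 ^ j))"
    unfolding F_inverse_formula_def Let_def q[symmetric] ty u w S_def by (simp add: h)
  have aq: "a ^ (q - 1) = 1"
    using Kq[OF a(1)] a(2) qpos by (metis mult_cancel_left2 power_eq_if not_gr_zero)
  have q_half: "q = 2 * 2 ^ (m - 1)" using q m by (cases m) simp_all
  have "F_inverse_formula m n a g y = x"
  proof (cases "w = 0")
    case True
    \<comment> \<open>Every exponent of \<open>w\<close> in the last sum is positive, so all its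
      summands vanish.\<close>
    have "(2::nat) ^ Suc j < 2 ^ m" if "j < m - 1" for j
      by (rule power_strict_increasing) (use that in auto)
    hence "(\<Sum>j<m - 1. a ^ (2 ^ j - 1) * w ^ (2 ^ m - 2 ^ (j + 1)) * S y ^ (2 ^ j)) = 0"
      by (intro sum.neutral) (auto simp: True power_0_left not_le[symmetric])
    hence "F_inverse_formula m n a g y = a ^ (2 ^ (m - 1) - 1) * y ^ (2 ^ (n * m - 1))"
      using q2 unfolding formula by (simp add: True power_0_left)
    also have "y ^ (2 ^ (n * m - 1)) = a ^ (2 ^ (n * m - 1)) * x ^ (2 * 2 ^ (n * m - 1))"
      by (simp add: y True power_mult_distrib flip: power_mult)
    also have "2 * 2 ^ (n * m - 1) = q ^ n"
      using m h by (simp add: q mult.commute flip: power_mult power_Suc)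
    \<comment> \<open>The factor \<open>q ^ (n - 1)\<close> acts trivially on \<open>a\<close>,
      leaving the exponents of \<open>a\<close> to add up to \<open>q - 1\<close>.\<close>
    also have "2 ^ (n * m - 1) = q ^ (n - 1) * 2 ^ (m - 1)"
      using m by (simp add: q h algebra_simps flip: power_mult power_add)
    also have "a ^ (q ^ (n - 1) * 2 ^ (m - 1)) = a ^ (2 ^ (m - 1))"
      by (simp add: power_mult Kqi a)
    also have "a ^ (2 ^ (m - 1) - 1) * (a ^ (2 ^ (m - 1)) * x ^ (q ^ n)) = a ^ (q - 1) * x"
    proof -
      have "a ^ (2 ^ (m - 1) - 1) * a ^ (2 ^ (m - 1)) = a ^ (q - 1)"
        by (simp add: q_half mult_2 flip: power_add)
      thus ?thesis by (simp add: Uq flip: mult.assoc)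
    qed
    finally show ?thesis unfolding aq by simp
  next
    case False
    have wq: "w ^ (q - 1) = 1"
      using Kq[OF wK] False qpos by (metis mult_cancel_left2 power_eq_if not_gr_zero)
    have half: "y ^ (2 ^ ((2 * k + 1) * m - 1)) = (y ^ (q ^ (2 * k))) ^ (2 ^ (m - 1))" for k
    proof -
      have "(2 * k + 1) * m - 1 = m * (2 * k) + (m - 1)" using m by (simp add: algebra_simps)
      thus ?thesis by (simp add: q power_add power_mult)
    qed
    \<comment> \<open>Since \<open>n = 2*h+1\<close>, the leading power is the \<open>k = h\<close>
      member of the shifted family, which completes a square root of \<open>y ^ (q ^ (2*k))\<close>
      for each \<open>k\<close>.\<close>
    have "y ^ (2 ^ (n * m - 1)) + (\<Sum>k = 1..h. y ^ (2 ^ ((2 * k - 1) * m - 1)))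
        = (\<Sum>k = 0..h. y ^ (2 ^ ((2 * k + 1) * m - 1)))"
    proof -
      have "(\<Sum>k = 1..h. y ^ (2 ^ ((2 * k - 1) * m - 1)))
          = (\<Sum>k<h. y ^ (2 ^ ((2 * k + 1) * m - 1)))"
        by (simp add: sum.atLeast1_atMost_eq)
      thus ?thesis
        by (simp add: h atLeast0AtMost add.commute flip: lessThan_Suc_atMost)
    qed
    also have "\<dots> = S y ^ (2 ^ (m - 1))"
      unfolding half S_def
      by (rule freshmans_dream_sum'[symmetric]) (use c2 in auto)
    finally have SS: "y ^ (2 ^ (n * m - 1)) + (\<Sum>k = 1..h. y ^ (2 ^ ((2 * k - 1) * m - 1)))
        = S y ^ (2 ^ (m - 1))" .
    have "F_inverse_formula m n a g y = T +
        a ^ (2 ^ (m - 1) - 1) *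
          (y ^ (2 ^ (n * m - 1)) + (\<Sum>k = 1..h. y ^ (2 ^ ((2 * k - 1) * m - 1))))
         + (\<Sum>j<m - 1. a ^ (2 ^ j - 1) * w ^ (2 ^ m - 2 ^ (j + 1)) * S y ^ (2 ^ j))"
      unfolding formula wq by (simp add: algebra_simps)
    \<comment> \<open>The collected term is the missing summand \<open>j = m - 1\<close>, where the
      exponent of \<open>w\<close> is 0.\<close>
    also have "\<dots> = T + (\<Sum>j<m. a ^ (2 ^ j - 1) * w ^ (2 ^ m - 2 ^ (j + 1)) * S y ^ (2 ^ j))"
      unfolding SS using m by (cases m) (simp_all add: algebra_simps)
    also have "(\<Sum>j<m. a ^ (2 ^ j - 1) * w ^ (2 ^ m - 2 ^ (j + 1)) * S y ^ (2 ^ j))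
        = (\<Sum>j<m. w / a * (a * S y / w^2) ^ (2 ^ j))"
    proof (rule sum.cong)
      fix j assume "j \<in> {..<m}"
      hence le: "(2::nat) ^ Suc j \<le> 2 ^ m" by (intro power_increasing) auto
      \<comment> \<open>From \<open>w ^ q = w\<close>, the complementary exponent becomes division
        by a power of \<open>w^2\<close>.\<close>
      have "w ^ (2 ^ m - 2 ^ (j + 1)) * w ^ (2 ^ (j + 1)) = w"
        using le Kq[OF wK] q by (simp flip: power_add)
      hence 1: "w ^ (2 ^ m - 2 ^ (j + 1)) = w / (w^2) ^ (2 ^ j)"
        using False by (simp add: field_simps flip: power_mult)
      have 2: "a ^ (2 ^ j - 1) = a ^ (2 ^ j) / a"
        using a(2) by (simp add: power_diff)
      show "a ^ (2 ^ j - 1) * w ^ (2 ^ m - 2 ^ (j + 1)) * S y ^ (2 ^ j)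
          = w / a * (a * S y / w^2) ^ (2 ^ j)"
        unfolding 1 2 by (simp add: power_divide power_mult_distrib)
    qed simp
    also have "a * S y / w^2 = a * S x / w + (a * S x / w)^2"
    proof -
      have "S y = w * S x + a * (S x)^2"
        by (simp add: S_def ypow sum.distrib flip: sum_distrib_left sq_sum)
      thus ?thesis using False by (simp add: field_simps power2_eq_square)
    qed
    also have "(\<Sum>j<m. w / a * (a * S x / w + (a * S x / w)^2) ^ (2 ^ j))
        = w / a * (a * S x / w + (a * S x / w) ^ q)"
      unfolding q by (simp only: sum_artin_schreier_telescope[OF c2] flip: sum_distrib_left)
    also have "(a * S x / w) ^ q = a * S x ^ q / w"
      by (simp add: power_divide power_mult_distrib Kq wK a)
    also have "w / a * (a * S x / w + a * S x ^ q / w) = S x + S x ^ q"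
      using False a(2) by (simp add: field_simps)
    also have "\<dots> = T + x"
      using sum_even_frobenius_powers[OF pc qc, of x h] Uq[of x]
      unfolding S_def T_def tr unfolding h by simp
    also have "T + (T + x) = x" using dbl[of T] by (simp flip: add.assoc)
    finally show ?thesis .
  qed
  thus ?thesis by (simp add: y_def)
qed

theorem theorem2p3:
  fixes m n q :: nat
    and K :: "'a::{field,finite} set"
    and L g :: "'a poly"
    and a :: 'a
  assumes "m > 0" and "q = 2 ^ m" and "odd n"
    and "card (UNIV :: 'a set) = q ^ n"
    and "is_subfield K" and "card K = q"
    and "linearized_poly K m L"
    and "permutation_poly K (monom 1 1 * L)"
    and "compositional_inverse K (monom 1 1 * L) g"
    and "a \<in> K" and "a \<noteq> 0"
  shows "permutation_poly UNIV (F_poly q n a L) \<and>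
    (\<forall>G. compositional_inverse UNIV (F_poly q n a L) G \<longleftrightarrow>
         (\<forall>x. poly G x = F_inverse_formula m n a g x))"
proof -
  let ?F = "poly (F_poly q n a L)"
  have left_inv: "F_inverse_formula m n a g (?F x) = x" for x
    using assms by (intro F_inverse_formula_F_poly)
  hence "inj ?F" by (metis injI)
  hence bij: "bij ?F" by (simp add: bij_def finite_UNIV_inj_surj)
  hence perm: "permutation_poly UNIV (F_poly q n a L)"
    by (simp add: permutation_poly_def poly_over_def)
  \<comment> \<open>Surjectivity writes \<open>y\<close> as an image under \<open>?F\<close>, where
    the left inverse identity applies.\<close>
  have "inv ?F y = F_inverse_formula m n a g y" for y
    using left_inv[of "inv ?F y"] bij by (simp add: bij_is_surj surj_f_inv_f)
  thus ?thesis
    using perm by (simp add: compositional_inverse_def poly_over_def)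
qed

end
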